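(* Let $-\pi/2<\lambda<\pi/2$. Let $q$ be analytic in $\mathbb{D}$ with $q(0)=1$, and suppose that $q$ satisfies the differential subordination \[ q(z)+\frac{zq'(z)}{q(z)}\prec P_{\lambda}(z)\quad\text{in }\mathbb{D}. \] Then \[ q(R_{2}z)\prec P_{0}(z)\quad\text{in }\mathbb{D}, \] where \[ R_{2}=R_{2}(\lambda)=\frac{2}{\sqrt{4+2\sqrt{3}\,|\sin(2\lambda)|}}. \]
   Context: $\mathbb{D}=\{z\in\mathbb{C}:|z|<1\}$. For analytic functions $f,F$ on $\mathbb{D}$, $f$ is subordinate to $F$ in $\mathbb{D}$, written $f\prec F$ or $f(z)\prec F(z)$, if there is an analytic function $\omega$ on $\mathbb{D}$ with $\omega(0)=0$, $|\omega(z)|<1$ and $f(z)=F(\omega(z))$ for all $z\in\mathbb{D}$. The hypothesis on $q$ includes that $q+zq'/q$ is analytic in $\mathbb{D}$. For $-\pi/2<\lambda<\pi/2$, $P_{\lambda}(z)=\dfrac{1+e^{2i\lambda}z}{1-z}$; in particular $P_0(z)=\dfrac{1+z}{1-z}$. *)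

theory Defs
  imports "HOL-Complex_Analysis.Complex_Analysis"
begin

definition subordinate :: "(complex \<Rightarrow> complex) \<Rightarrow> (complex \<Rightarrow> complex) \<Rightarrow> bool"
    (infix \<open>\<prec>\<^sub>D\<close> 50) where
  "f \<prec>\<^sub>D F \<longleftrightarrow>
     f analytic_on ball 0 1 \<and> F analytic_on ball 0 1 \<and>
     (\<exists>\<omega>. \<omega> analytic_on ball 0 1 \<and> \<omega> 0 = 0 \<and>
        (\<forall>z\<in>ball 0 1. norm (\<omega> z) < 1 \<and> f z = F (\<omega> z)))"

definition P :: "real \<Rightarrow> complex \<Rightarrow> complex" where
  "P lam z = (1 + exp (2 * \<i> * of_real lam) * z) / (1 - z)"

definition R\<^sub>2 :: "real \<Rightarrow> real" where
  "R\<^sub>2 lam = 2 / sqrt (4 + 2 * sqrt 3 * \<bar>sin (2 * lam)\<bar>)"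

text \<open>
  In \<open>q z + z * deriv q z / q z\<close> division by zero yields zero, so at a zero of \<open>q\<close> the
  expression still denotes a number. Analyticity on the disc, which \<open>subordinate\<close> demands
  of its left argument, nevertheless has its usual force: when \<open>q\<close> is analytic and \<open>q 0 = 1\<close>,
  every zero of \<open>q\<close> in the disc is a pole of \<open>z * deriv q z / q z\<close>, whatever
  value is assigned at the zero itself, so analyticity rules such zeros out.
\<close>

end

theory Submission
  imports Defs
begin

text \<open>
  Write \<open>p z = q z + z * deriv q z / q z\<close>. The conclusion says that \<open>q\<close> takes the disc of radius
  \<open>R\<^sub>2 lam\<close> into the right half-plane, because \<open>w \<mapsto> (w - 1) / (w + 1)\<close> maps that half-plane onto
  the unit disc and inverts \<open>P 0\<close>. If it failed, there would be a point \<open>z\<close> of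
  least modulus \<open>r < R\<^sub>2 lam\<close> at which \<open>q\<close> leaves the half-plane, say \<open>q z = \<i> * s\<close> with \<open>s\<close> real.
  The number \<open>p z\<close> is then constrained in two incompatible ways.

  First, \<open>q\<close> has no zeros, since \<open>p\<close> would have a pole there; so \<open>s \<noteq> 0\<close>.
  The boundary form of the Schwarz lemma (\<open>first_exit_from_half_plane\<close>, a variant of Jack's
  lemma) shows that \<open>z * deriv q z\<close> is a real number not exceeding \<open>- (1 + s\<^sup>2) / 2\<close>. So
  \<open>p z = \<i> * t\<close> with \<open>t\<close> real and \<open>\<bar>t\<bar> \<ge> (3 * \<bar>s\<bar> + 1 / \<bar>s\<bar>) / 2 \<ge> sqrt 3\<close>.

  Second, \<open>p z = P lam (\<omega> z)\<close> with \<open>norm (\<omega> z) \<le> r\<close>, by the Schwarz lemma for \<open>\<omega>\<close>. The image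
  of the disc of radius \<open>r\<close> under \<open>P lam\<close> is a disc that meets the imaginary axis only at points
  \<open>\<i> * t\<close> with \<open>\<bar>t\<bar> + 1 / \<bar>t\<bar> \<le> 2 * \<bar>sin (2 * lam)\<bar> * r\<^sup>2 / (1 - r\<^sup>2)\<close>. As \<open>\<bar>t\<bar> \<ge> sqrt 3\<close>, the left
  side is at least \<open>4 / sqrt 3\<close>, which forces \<open>r \<ge> R\<^sub>2 lam\<close>.
\<close>

section \<open>Absence of zeros\<close>

text \<open>
  At a zero of order \<open>n\<close> the quotient \<open>deriv f / f\<close> has a simple pole with residue \<open>n\<close>, which
  the factor \<open>a\<close> cannot cancel where it does not vanish.
\<close>

lemma no_zero_if_log_deriv_holomorphic:
  fixes f a u :: "complex \<Rightarrow> complex"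
  assumes S: "open S" "connected S"
    and f: "f holomorphic_on S" and a: "continuous_on S a" and u: "continuous_on S u"
    and eq: "\<And>z. z \<in> S \<Longrightarrow> f z \<noteq> 0 \<Longrightarrow> a z * deriv f z / f z = u z"
    and c: "c \<in> S" "f c \<noteq> 0" and z0: "z0 \<in> S" "a z0 \<noteq> 0"
  shows "f z0 \<noteq> 0"
proof
  assume "f z0 = 0"
  moreover have "\<not> f constant_on S"
    using c z0 \<open>f z0 = 0\<close> unfolding constant_on_def by metis
  ultimately obtain g r n where "0 < n" "0 < r" and sub: "ball z0 r \<subseteq> S"
    and g: "g holomorphic_on ball z0 r"
    and fac: "\<And>w. w \<in> ball z0 r \<Longrightarrow> f w = (w - z0) ^ n * g w"
    and g0: "\<And>w. w \<in> ball z0 r \<Longrightarrow> g w \<noteq> 0"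
    using holomorphic_factor_zero_nonconstant[OF f S z0(1)] by metis
  \<comment> \<open>Clearing denominators leaves an identity that is continuous at \<open>z0\<close>.\<close>
  define L where "L w = a w * (of_nat n * g w + (w - z0) * deriv g w)" for w
  define M where "M w = u w * (w - z0) * g w" for w
  have LM: "L w = M w" if w: "w \<in> ball z0 r" "w \<noteq> z0" for w
  proof -
    have dg: "(g has_field_derivative deriv g w) (at w)"
      using g w(1) holomorphic_derivI open_ball by blast
    have "((\<lambda>w. (w - z0) ^ n * g w) has_field_derivative
            of_nat n * (w - z0) ^ (n - 1) * g w + (w - z0) ^ n * deriv g w) (at w)"
      by (rule derivative_eq_intros dg refl | simp)+
    then have "(f has_field_derivative
            of_nat n * (w - z0) ^ (n - 1) * g w + (w - z0) ^ n * deriv g w) (at w)"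
      by (rule has_field_derivative_transform_within_open[OF _ open_ball w(1)]) (simp add: fac)
    then have df: "deriv f w = of_nat n * (w - z0) ^ (n - 1) * g w + (w - z0) ^ n * deriv g w"
      by (rule DERIV_imp_deriv)
    have pow: "(w - z0) ^ n = (w - z0) ^ (n - 1) * (w - z0)"
      using \<open>0 < n\<close> by (metis power_minus_mult)
    have "f w \<noteq> 0"
      using fac g0 w by simp
    then have "a w * deriv f w = u w * f w"
      using eq[of w] w sub by (auto simp: field_simps)
    then have "(w - z0) ^ (n - 1) * L w = (w - z0) ^ (n - 1) * M w"
      unfolding df fac[OF w(1)] pow L_def M_def by (simp add: algebra_simps)
    then show ?thesis
      using w(2) by simp
  qed
  have "continuous_on (ball z0 r) (\<lambda>w. L w - M w)"
    unfolding L_def M_def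
    by (intro continuous_intros continuous_on_subset[OF a sub] continuous_on_subset[OF u sub]
        holomorphic_on_imp_continuous_on g holomorphic_deriv open_ball)
  then have "isCont (\<lambda>w. L w - M w) z0"
    using \<open>0 < r\<close> by (simp add: continuous_on_eq_continuous_at)
  then have "((\<lambda>w. L w - M w) \<longlongrightarrow> L z0 - M z0) (at z0)"
    by (simp add: isCont_def)
  moreover have "((\<lambda>w. L w - M w) \<longlongrightarrow> 0) (at z0)"
  proof (rule tendsto_eventually)
    show "\<forall>\<^sub>F w in at z0. L w - M w = 0"
      unfolding eventually_at_topological
      by (rule exI[of _ "ball z0 r"]) (use LM \<open>0 < r\<close> in auto)
  qed
  ultimately have "L z0 - M z0 = 0"
    using tendsto_unique trivial_limit_at by blast
  then have "a z0 * (of_nat n * g z0) = 0"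
    by (simp add: L_def M_def)
  then show False
    using \<open>0 < n\<close> z0(2) g0[of z0] \<open>0 < r\<close> by simp
qed

section \<open>Leaving the right half-plane\<close>

lemma norm_Cayley_less_1:
  assumes "0 < Re w"
  shows "norm ((w - 1) / (w + 1)) < 1"
proof -
  have "(norm (w - 1))\<^sup>2 < (norm (w + 1))\<^sup>2"
    using assms unfolding cmod_power2 by (simp add: power2_eq_square algebra_simps)
  then have "norm (w - 1) < norm (w + 1)"
    by (simp add: power2_less_imp_less)
  moreover from this have "0 < norm (w + 1)"
    by (meson le_less_trans norm_ge_zero)
  ultimately show ?thesis
    by (simp add: norm_divide)
qed

lemma P0_Cayley:
  assumes "w + 1 \<noteq> 0"
  shows "P 0 ((w - 1) / (w + 1)) = w"
proof -
  have "1 + (w - 1) / (w + 1) = 2 * w / (w + 1)" "1 - (w - 1) / (w + 1) = 2 / (w + 1)"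
    using assms by (simp_all add: field_simps)
  then show ?thesis
    using assms by (simp add: P_def)
qed

text \<open>
  The Cayley transform \<open>(q - 1) / (q + 1)\<close> maps the disc of radius \<open>r\<close> into the unit disc and
  vanishes at \<open>0\<close>; after rescaling, the Schwarz lemma bounds it by \<open>norm z / r\<close>.
\<close>

lemma Schwarz_half_plane:
  assumes q: "q holomorphic_on ball 0 r" "q 0 = 1" and pos: "\<And>z. z \<in> ball 0 r \<Longrightarrow> 0 < Re (q z)"
    and z: "z \<in> ball 0 r"
  shows "r * norm (q z - 1) \<le> norm z * norm (q z + 1)"
proof -
  define w where "w \<zeta> = (q (of_real r * \<zeta>) - 1) / (q (of_real r * \<zeta>) + 1)" for \<zeta>
  have "0 < r"
    using z by (metis dist_0_norm le_less_trans mem_ball norm_ge_zero)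
  have in_ball: "of_real r * \<zeta> \<in> ball 0 r" if "\<zeta> \<in> ball 0 1" for \<zeta> :: complex
    using that \<open>0 < r\<close> by (simp add: norm_mult)
  have ne: "q \<zeta> + 1 \<noteq> 0" if "\<zeta> \<in> ball 0 r" for \<zeta>
    using pos[OF that] by (auto simp: complex_eq_iff)
  have "(\<lambda>\<zeta>. q (of_real r * \<zeta>)) holomorphic_on ball 0 1"
    using in_ball
    by (intro holomorphic_on_compose_gen[OF _ q(1), unfolded o_def] holomorphic_intros) blast
  then have "w holomorphic_on ball 0 1"
    unfolding w_def using ne in_ball by (intro holomorphic_intros) auto
  moreover have "w 0 = 0"
    by (simp add: w_def q)
  moreover have "norm (w \<zeta>) < 1" if "norm \<zeta> < 1" for \<zeta>
    unfolding w_def using that in_ball by (intro norm_Cayley_less_1 pos) simp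
  moreover have "norm (z / of_real r) < 1"
    using z \<open>0 < r\<close> by (simp add: norm_divide)
  ultimately have "norm (w (z / of_real r)) \<le> norm (z / of_real r)"
    using Schwarz_Lemma(1) by blast
  then show ?thesis
    using ne[OF z] \<open>0 < r\<close> by (simp add: w_def norm_divide field_simps)
qed

lemma left_deriv_nonpos:
  fixes h :: "real \<Rightarrow> real"
  assumes d: "(h has_real_derivative l) (at 1)" and h1: "h 1 = 0"
    and h: "\<And>t. 0 < t \<Longrightarrow> t < 1 \<Longrightarrow> 0 \<le> h t"
  shows "l \<le> 0"
proof (rule ccontr)
  assume "\<not> l \<le> 0"
  then obtain \<delta> where "0 < \<delta>" and \<delta>: "\<And>e. 0 < e \<Longrightarrow> e < \<delta> \<Longrightarrow> h (1 - e) < h 1"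
    using DERIV_pos_inc_left[OF d] by auto
  define e where "e = min (\<delta> / 2) (1 / 2)"
  have "0 < e" "e < \<delta>" "e < 1"
    using \<open>0 < \<delta>\<close> by (auto simp: e_def min_def)
  then show False
    using \<delta>[of e] h[of "1 - e"] h1 by simp
qed

text \<open>
  On the circle through \<open>z0\<close> the real part of \<open>q\<close> is minimal at \<open>z0\<close>, so its tangential derivative
  vanishes; this makes \<open>z0 * deriv q z0\<close> real. Along the radius to \<open>z0\<close> the Schwarz lemma
  bounds \<open>q\<close> by a function that agrees with it at \<open>z0\<close>, and the comparison of radial derivatives
  gives the inequality.
\<close>

lemma first_exit_from_half_plane:
  assumes S: "open S" "cball 0 (norm z0) \<subseteq> S" and q: "q holomorphic_on S" "q 0 = 1"
    and pos: "\<And>z. norm z < norm z0 \<Longrightarrow> 0 < Re (q z)"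
    and exit: "Re (q z0) = 0"
  shows "Im (z0 * deriv q z0) = 0" and "Re (z0 * deriv q z0) \<le> - (1 + (Im (q z0))\<^sup>2) / 2"
proof -
  have "z0 \<noteq> 0"
    using q(2) exit by auto
  have dq: "(q has_field_derivative deriv q z0) (at z0)"
    using S q(1) by (intro holomorphic_derivI[where S = S]) auto
  have cont: "continuous_on (cball 0 (norm z0)) q"
    using S(2) q(1) by (meson continuous_on_subset holomorphic_on_imp_continuous_on)
  have nonneg: "0 \<le> Re (q z)" if "norm z = norm z0" for z
  proof (rule continuous_ge_on_closure[where f = "\<lambda>z. Re (q z)" and S = "ball 0 (norm z0)"])
    show "continuous_on (closure (ball 0 (norm z0))) (\<lambda>z. Re (q z))"
      using cont \<open>z0 \<noteq> 0\<close> by (simp add: continuous_on_Re)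
    show "z \<in> closure (ball 0 (norm z0))"
      using that \<open>z0 \<noteq> 0\<close> by simp
  qed (use pos in \<open>auto intro: less_imp_le\<close>)

  have "((\<lambda>\<zeta>. q (z0 * exp (\<i> * \<zeta>))) has_field_derivative deriv q z0 * (z0 * \<i>)) (at (of_real 0))"
    using dq by (intro DERIV_chain2[where f = q]) (auto intro!: derivative_eq_intros)
  from has_vector_derivative_real_field[OF this, of UNIV]
  have "((\<lambda>\<theta>. q (z0 * cis \<theta>)) has_vector_derivative z0 * \<i> * deriv q z0) (at 0)"
    by (simp add: cis_conv_exp mult_ac)
  then have "((\<lambda>\<theta>. Re (q (z0 * cis \<theta>))) has_real_derivative Re (z0 * \<i> * deriv q z0)) (at 0)"
    unfolding has_real_derivative_iff_has_vector_derivative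
    by (rule bounded_linear.has_vector_derivative[OF bounded_linear_Re])
  moreover have "\<forall>\<theta>. \<bar>0 - \<theta>\<bar> < 1 \<longrightarrow> Re (q (z0 * cis 0)) \<le> Re (q (z0 * cis \<theta>))"
    using nonneg exit by (simp add: norm_mult)
  ultimately have "Re (z0 * \<i> * deriv q z0) = 0"
    by (rule DERIV_local_min[OF _ zero_less_one])
  then show "Im (z0 * deriv q z0) = 0"
    by (simp add: algebra_simps)

  define x where "x t = Re (q (of_real t * z0))" for t
  define y where "y t = Im (q (of_real t * z0))" for t
  have "((\<lambda>\<zeta>. q (\<zeta> * z0)) has_field_derivative deriv q z0 * z0) (at (of_real 1))"
    using dq by (intro DERIV_chain2[where f = q]) (auto intro!: derivative_eq_intros)
  from has_vector_derivative_real_field[OF this, of UNIV]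
  have v: "((\<lambda>t. q (of_real t * z0)) has_vector_derivative z0 * deriv q z0) (at 1)"
    by (simp add: mult_ac)
  have dx: "(x has_real_derivative Re (z0 * deriv q z0)) (at 1)"
    unfolding x_def has_real_derivative_iff_has_vector_derivative
    by (rule bounded_linear.has_vector_derivative[OF bounded_linear_Re v])
  have dy: "(y has_real_derivative Im (z0 * deriv q z0)) (at 1)"
    unfolding y_def has_real_derivative_iff_has_vector_derivative
    by (rule bounded_linear.has_vector_derivative[OF bounded_linear_Im v])
  \<comment> \<open>This is \<open>t\<^sup>2 * (norm (q + 1))\<^sup>2 - (norm (q - 1))\<^sup>2\<close> along the radius. The Schwarz lemma makes
      it nonnegative for \<open>t < 1\<close>, and it vanishes at \<open>t = 1\<close>.\<close>
  define h where "h t = t\<^sup>2 * ((x t + 1)\<^sup>2 + (y t)\<^sup>2) - ((x t - 1)\<^sup>2 + (y t)\<^sup>2)" for t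
  have x1: "x 1 = 0" and y1: "y 1 = Im (q z0)"
    using exit by (auto simp: x_def y_def)
  have "(h has_real_derivative 2 * (1 + (Im (q z0))\<^sup>2) + 4 * Re (z0 * deriv q z0)) (at 1)"
    unfolding h_def
    by (rule derivative_eq_intros dx dy refl | simp)+
      (simp add: x1 y1 power2_eq_square algebra_simps)
  moreover have "h 1 = 0"
    by (simp add: h_def x1)
  moreover have "0 \<le> h t" if t: "0 < t" "t < 1" for t
  proof -
    let ?z = "of_real t * z0"
    have "norm z0 * norm (q ?z - 1) \<le> norm ?z * norm (q ?z + 1)"
      using q pos t \<open>z0 \<noteq> 0\<close> holomorphic_on_subset[OF q(1) order_trans[OF ball_subset_cball S(2)]]
      by (intro Schwarz_half_plane) (auto simp: norm_mult)
    then have "norm (q ?z - 1) \<le> t * norm (q ?z + 1)"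
      using t \<open>z0 \<noteq> 0\<close> by (simp add: norm_mult)
    then have "(norm (q ?z - 1))\<^sup>2 \<le> (t * norm (q ?z + 1))\<^sup>2"
      by (rule power_mono) simp
    then show ?thesis
      by (simp add: h_def x_def y_def cmod_power2 power_mult_distrib)
  qed
  ultimately have "2 * (1 + (Im (q z0))\<^sup>2) + 4 * Re (z0 * deriv q z0) \<le> 0"
    by (rule left_deriv_nonpos)
  then show "Re (z0 * deriv q z0) \<le> - (1 + (Im (q z0))\<^sup>2) / 2"
    by simp
qed

text \<open>
  At such an exit point the quantity \<open>q + z q' / q\<close> is imaginary and bounded away from zero: the
  modulus is at least \<open>(3 * \<bar>s\<bar> + 1 / \<bar>s\<bar>) / 2\<close>, which by the arithmetic-geometric mean inequality
  is at least \<open>sqrt 3\<close>.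
\<close>

lemma imaginary_value_at_exit:
  fixes m s :: real
  assumes "s \<noteq> 0" and m: "m \<le> - (1 + s\<^sup>2) / 2"
  obtains t where "\<i> * of_real s + of_real m / (\<i> * of_real s) = \<i> * of_real t" and "sqrt 3 \<le> \<bar>t\<bar>"
proof
  show "\<i> * of_real s + of_real m / (\<i> * of_real s) = \<i> * of_real (s - m / s)"
    using \<open>s \<noteq> 0\<close> by (simp add: field_simps)
  have "0 \<le> (sqrt 3 * \<bar>s\<bar> - 1)\<^sup>2"
    by simp
  then have "sqrt 3 * \<bar>s\<bar> \<le> (1 + 3 * s\<^sup>2) / 2"
    by (simp add: power2_eq_square algebra_simps)
  also have "\<dots> \<le> s\<^sup>2 - m"
    using m by simp
  also have "\<dots> \<le> \<bar>s * (s - m / s)\<bar>"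
    using \<open>s \<noteq> 0\<close> by (simp add: power2_eq_square algebra_simps)
  finally show "sqrt 3 \<le> \<bar>s - m / s\<bar>"
    using \<open>s \<noteq> 0\<close> by (simp add: abs_mult)
qed

section \<open>The half-plane of \<open>P lam\<close> and the radius\<close>

lemma R2_bounds: "0 < R\<^sub>2 lam" "R\<^sub>2 lam \<le> 1" "(R\<^sub>2 lam)\<^sup>2 * (4 + 2 * sqrt 3 * \<bar>sin (2 * lam)\<bar>) = 4"
proof -
  let ?D = "4 + 2 * sqrt 3 * \<bar>sin (2 * lam)\<bar>"
  have D: "4 \<le> ?D"
    by simp
  have "2 \<le> sqrt ?D"
    by (rule real_le_rsqrt) simp
  moreover from this have "0 < sqrt ?D"
    by linarith
  ultimately show "0 < R\<^sub>2 lam" "R\<^sub>2 lam \<le> 1"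
    unfolding R\<^sub>2_def by (simp_all only: divide_le_eq_1_pos zero_less_divide_iff) simp
  show "(R\<^sub>2 lam)\<^sup>2 * ?D = 4"
  proof -
    have "(R\<^sub>2 lam)\<^sup>2 = 4 / ?D"
      using D unfolding R\<^sub>2_def power_divide by (subst real_sqrt_pow2) auto
    moreover have "?D \<noteq> 0"
      using D by linarith
    ultimately show ?thesis
      using nonzero_eq_divide_eq[of ?D "(R\<^sub>2 lam)\<^sup>2" 4] by blast
  qed
qed

text \<open>
  Solving \<open>P lam w = \<i> * t\<close> for \<open>w\<close> gives \<open>(norm w)\<^sup>2 = (1 + t\<^sup>2) / (1 + t\<^sup>2 + 2 * t * sin (2 * lam))\<close>.
  This is at least \<open>Q / (Q + 2 * \<bar>sin (2 * lam)\<bar>)\<close> with \<open>Q = (1 + t\<^sup>2) / \<bar>t\<bar>\<close>, which does not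
  decrease with \<open>Q\<close>. Over \<open>\<bar>t\<bar> \<ge> sqrt 3\<close> the least value of \<open>Q\<close> is \<open>4 / sqrt 3\<close>, attained at
  \<open>\<bar>t\<bar> = sqrt 3\<close>, and there the bound is \<open>(R\<^sub>2 lam)\<^sup>2\<close>.
\<close>

lemma norm_ge_R2_if_P_imaginary:
  assumes w: "norm w < 1" and eq: "P lam w = \<i> * of_real t" and t: "sqrt 3 \<le> \<bar>t\<bar>"
  shows "R\<^sub>2 lam \<le> norm w"
proof -
  let ?S = "\<bar>sin (2 * lam)\<bar>" and ?r = "norm w"
  let ?e = "exp (2 * \<i> * of_real lam)"
  have e: "?e = cis (2 * lam)"
    by (simp add: cis_conv_exp mult_ac)
  have "1 - w \<noteq> 0"
    using w by auto
  then have "w * (?e + \<i> * of_real t) = \<i> * of_real t - 1"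
    using eq unfolding P_def by (simp add: field_simps)
  then have "(?r)\<^sup>2 * (norm (?e + \<i> * of_real t))\<^sup>2 = (norm (\<i> * of_real t - 1))\<^sup>2"
    by (metis norm_mult power_mult_distrib)
  moreover have "(norm (?e + \<i> * of_real t))\<^sup>2 = 1 + t\<^sup>2 + 2 * t * sin (2 * lam)"
    unfolding e cmod_power2 by (simp add: power2_sum algebra_simps)
  moreover have "(norm (\<i> * of_real t - 1))\<^sup>2 = 1 + t\<^sup>2"
    unfolding cmod_power2 by simp
  ultimately have "1 + t\<^sup>2 = (?r)\<^sup>2 * (1 + t\<^sup>2 + 2 * t * sin (2 * lam))"
    by simp
  also have "\<dots> \<le> (?r)\<^sup>2 * (1 + t\<^sup>2 + 2 * (\<bar>t\<bar> * ?S))"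
    by (intro mult_left_mono) (auto simp: abs_mult[symmetric] mult.assoc)
  finally have A: "(1 + t\<^sup>2) * (1 - (?r)\<^sup>2) \<le> 2 * (?r)\<^sup>2 * \<bar>t\<bar> * ?S"
    by (simp add: algebra_simps)
  have "1 \<le> sqrt 3 * \<bar>t\<bar>"
    using mult_left_mono[OF t, of "sqrt 3"] by simp
  then have "0 \<le> (sqrt 3 * \<bar>t\<bar> - 1) * (\<bar>t\<bar> - sqrt 3)"
    using t by simp
  then have B: "4 * \<bar>t\<bar> \<le> sqrt 3 * (1 + t\<^sup>2)"
    by (simp add: power2_eq_square algebra_simps)
  have "(?r)\<^sup>2 \<le> 1"
    using w by (simp add: abs_square_le_1)
  then have "4 * \<bar>t\<bar> * (1 - (?r)\<^sup>2) \<le> sqrt 3 * ((1 + t\<^sup>2) * (1 - (?r)\<^sup>2))"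
    using mult_right_mono[OF B, of "1 - (?r)\<^sup>2"] by (simp add: mult.assoc)
  also have "\<dots> \<le> sqrt 3 * (2 * (?r)\<^sup>2 * \<bar>t\<bar> * ?S)"
    using A by (intro mult_left_mono) auto
  finally have "\<bar>t\<bar> * 4 \<le> \<bar>t\<bar> * ((?r)\<^sup>2 * (4 + 2 * sqrt 3 * ?S))"
    by (simp add: algebra_simps)
  moreover have "0 < \<bar>t\<bar>"
    using t by (smt (verit) real_sqrt_gt_zero)
  ultimately have "4 \<le> (?r)\<^sup>2 * (4 + 2 * sqrt 3 * ?S)"
    by simp
  then have "(R\<^sub>2 lam)\<^sup>2 * (4 + 2 * sqrt 3 * ?S) \<le> (?r)\<^sup>2 * (4 + 2 * sqrt 3 * ?S)"
    by (simp add: R2_bounds)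
  moreover have "0 < 4 + 2 * sqrt 3 * ?S"
    by (smt (verit) mult_nonneg_nonneg real_sqrt_ge_zero abs_ge_zero)
  ultimately have "(R\<^sub>2 lam)\<^sup>2 \<le> (?r)\<^sup>2"
    by simp
  then show ?thesis
    by (rule power2_le_imp_le) simp
qed

section \<open>The first exit point\<close>

lemma Re_pos_below_R2:
  assumes q: "q analytic_on ball 0 1" "q 0 = 1"
    and sub: "(\<lambda>z. q z + z * deriv q z / q z) \<prec>\<^sub>D P lam"
    and z: "norm z < R\<^sub>2 lam"
  shows "0 < Re (q z)"
proof (rule ccontr)
  assume neg: "\<not> 0 < Re (q z)"
  let ?p = "\<lambda>z. q z + z * deriv q z / q z"
  have hol: "q holomorphic_on ball 0 1"
    using q(1) by (simp add: analytic_on_open)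
  have p: "?p holomorphic_on ball 0 1"
    using sub by (simp add: subordinate_def analytic_on_open)
  from sub obtain \<omega> where \<omega>: "\<omega> holomorphic_on ball 0 1" "\<omega> 0 = 0"
      "\<And>z. norm z < 1 \<Longrightarrow> norm (\<omega> z) < 1" "\<And>z. norm z < 1 \<Longrightarrow> ?p z = P lam (\<omega> z)"
    unfolding subordinate_def by (auto simp: analytic_on_open)

  have "norm z < 1"
    using z R2_bounds(2)[of lam] by simp
  have cont: "continuous_on (cball 0 (norm z)) (\<lambda>\<zeta>. Re (q \<zeta>))"
    using \<open>norm z < 1\<close> holomorphic_on_imp_continuous_on[OF hol]
    by (intro continuous_on_Re) (auto intro: continuous_on_subset)
  \<comment> \<open>Compactness yields a point \<open>z0\<close> of least modulus where the real part is not positive.\<close>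
  define K where "K = {\<zeta> \<in> cball 0 (norm z). Re (q \<zeta>) \<le> 0}"
  have "compact K"
  proof -
    have "closed K"
      unfolding K_def
      by (rule continuous_on_closed_Collect_le[OF cont continuous_on_const closed_cball])
    then show ?thesis
      unfolding compact_eq_bounded_closed
      by (auto simp: K_def intro: bounded_subset[OF bounded_cball, of _ 0 "norm z"])
  qed
  moreover have "z \<in> K"
    using neg by (simp add: K_def)
  ultimately obtain z0 where "z0 \<in> K" and least: "\<And>\<zeta>. \<zeta> \<in> K \<Longrightarrow> norm z0 \<le> norm \<zeta>"
    using continuous_attains_inf[of K norm] by (auto intro: continuous_intros)
  then have z0: "norm z0 \<le> norm z" "Re (q z0) \<le> 0"
    by (auto simp: K_def)
  have "norm z0 < 1"
    using z0 \<open>norm z < 1\<close> by simp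
  have "z0 \<noteq> 0"
    using z0 q(2) by auto
  have pos: "0 < Re (q \<zeta>)" if "norm \<zeta> < norm z0" for \<zeta>
    using least[of \<zeta>] that z0 by (force simp: K_def)
  have "0 \<le> Re (q z0)"
  proof (rule continuous_ge_on_closure[where f = "\<lambda>z. Re (q z)" and S = "ball 0 (norm z0)"])
    show "continuous_on (closure (ball 0 (norm z0))) (\<lambda>z. Re (q z))"
      using \<open>z0 \<noteq> 0\<close> z0 by (auto intro: continuous_on_subset[OF cont])
  qed (use \<open>z0 \<noteq> 0\<close> pos in \<open>auto intro: less_imp_le\<close>)
  with z0 have exit: "Re (q z0) = 0"
    by simp

  have "q z0 \<noteq> 0"
  proof (rule no_zero_if_log_deriv_holomorphic[where S = "ball 0 1" and f = q and ?z0.0 = z0 and a = "\<lambda>z. z"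
        and u = "\<lambda>z. ?p z - q z" and c = 0])
    show "continuous_on (ball 0 1) (\<lambda>z. ?p z - q z)"
      by (intro continuous_on_diff holomorphic_on_imp_continuous_on p hol)
  qed (use hol q(2) \<open>norm z0 < 1\<close> \<open>z0 \<noteq> 0\<close> in auto)
  define s where "s = Im (q z0)"
  define m where "m = Re (z0 * deriv q z0)"
  have qz0: "q z0 = \<i> * of_real s"
    using exit by (simp add: s_def complex_eq_iff)
  have "cball 0 (norm z0) \<subseteq> ball 0 1"
    using \<open>norm z0 < 1\<close> by auto
  note contact = first_exit_from_half_plane[OF open_ball this hol q(2) pos exit]
  have m: "z0 * deriv q z0 = of_real m" "m \<le> - (1 + s\<^sup>2) / 2"
    using contact by (simp_all add: m_def s_def complex_eq_iff)
  have "s \<noteq> 0"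
    using \<open>q z0 \<noteq> 0\<close> qz0 by auto
  then obtain t where t: "?p z0 = \<i> * of_real t" "sqrt 3 \<le> \<bar>t\<bar>"
    using imaginary_value_at_exit[OF _ m(2)] unfolding m(1) unfolding qz0 by metis
  have "R\<^sub>2 lam \<le> norm (\<omega> z0)"
    using \<omega>(3,4)[OF \<open>norm z0 < 1\<close>] t by (intro norm_ge_R2_if_P_imaginary) auto
  also have "norm (\<omega> z0) \<le> norm z0"
    using Schwarz_Lemma(1)[OF \<omega>(1-3) \<open>norm z0 < 1\<close>] .
  finally show False
    using z0 z by simp
qed

theorem theorem2:
  fixes lam :: real and q :: "complex \<Rightarrow> complex"
  assumes "- pi / 2 < lam" and "lam < pi / 2"
    and "q analytic_on ball 0 1" and "q 0 = 1"
    and "(\<lambda>z. q z + z * deriv q z / q z) \<prec>\<^sub>D P lam"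
  shows "(\<lambda>z. q (of_real (R\<^sub>2 lam) * z)) \<prec>\<^sub>D P 0"
proof -
  let ?f = "\<lambda>z. q (of_real (R\<^sub>2 lam) * z)"
  let ?w = "\<lambda>z. (?f z - 1) / (?f z + 1)"
  have scale: "norm (of_real (R\<^sub>2 lam) * z) < R\<^sub>2 lam" if "norm z < 1" for z :: complex
    using that R2_bounds(1)[of lam] by (simp add: norm_mult)
  have pos: "0 < Re (?f z)" if "norm z < 1" for z
    using assms scale[OF that] by (intro Re_pos_below_R2)
  have ne: "?f z + 1 \<noteq> 0" if "norm z < 1" for z
    using pos[OF that] by (auto simp: complex_eq_iff)
  have in_ball: "of_real (R\<^sub>2 lam) * z \<in> ball 0 1" if "z \<in> ball 0 1" for z :: complex
    using scale[of z] that R2_bounds(2)[of lam] by simp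
  have q: "q holomorphic_on ball 0 1"
    using assms(3) by (simp add: analytic_on_open)
  have f: "?f holomorphic_on ball 0 1"
    using in_ball
    by (intro holomorphic_on_compose_gen[OF _ q, unfolded o_def] holomorphic_intros) blast
  then have w: "?w holomorphic_on ball 0 1"
    using ne by (intro holomorphic_intros) auto
  have P0: "P 0 holomorphic_on ball 0 1"
    unfolding P_def by (intro holomorphic_intros) auto
  have "norm (?w z) < 1 \<and> ?f z = P 0 (?w z)" if "z \<in> ball 0 1" for z
    using pos[of z] ne[of z] that norm_Cayley_less_1[of "?f z"] P0_Cayley[of "?f z"] by simp
  moreover have "?w 0 = 0"
    by (simp add: assms(4))
  ultimately show ?thesis
    unfolding subordinate_def using f w P0 by (auto simp: analytic_on_open intro!: exI[of _ ?w])
qed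

end
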